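(* Let $C_0,C_1,C_2,\ldots$ be complex-valued random variables (not necessarily independent or identically distributed), each with absolutely continuous distribution, such that $$\mathbb{E}[|C_0|]=\mathbb{E}[|C_1|]=\cdots=\mu<\infty\quad\text{and}\quad \mathrm{Var}(|C_0|)=\mathrm{Var}(|C_1|)=\cdots=\sigma^2<\infty .$$ Let $P_n(z)=\sum_{k=0}^n C_kz^k$, let $r\in(0,1)$ and $0\le\alpha<\beta<2\pi$. Then, as $n\to\infty$, $$\mathbb{E}\left[\left|\tau_n\left(A_r(\alpha,\beta)\right)-\frac{\beta-\alpha}{2\pi}\right|\right]\le\left(\sqrt{\frac{2\pi}{\mathbf{k}}}+\frac{2}{1-r}\right)\sqrt{\frac{\log(n+1)-\frac12\mathbb{E}[\log|C_0|]-\frac12\mathbb{E}[\log|C_n|]+O(1)}{n}},$$ where $O(1)$ denotes a quantity that stays bounded as $n\to\infty$.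
   Context: $\mathbf{k}=\sum_{k=0}^\infty(-1)^k/(2k+1)^2$ is Catalan's constant. "Absolutely continuous" means having a density with respect to area measure on $\mathbb{C}$; in particular $C_0C_n\neq0$ almost surely, so $P_n$ has degree $n$ almost surely. $\tau_n=\frac1n\sum_{k=1}^n\delta_{Z_k}$ is the normalized counting measure of the $n$ complex zeros $Z_1,\dots,Z_n$ of $P_n$ (with multiplicity). The annular sector is $A_r(\alpha,\beta)=\{z\in\mathbb{C}: r<|z|<1/r,\ \alpha\le\arg z<\beta\}$, with $\arg z\in[0,2\pi)$. The expectations $\mathbb{E}[\log|C_k|]$ take values in $[-\infty,\infty)$; if one occurring in the bound equals $-\infty$, the right-hand side is read as $+\infty$. *)

theory Defs
  imports
    "HOL-Probability.Probability"
    "HOL-Computational_Algebra.Polynomial"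
begin

definition catalan_const :: real where
  "catalan_const = (\<Sum>k. (-1) ^ k / (2 * real k + 1)\<^sup>2)"

definition rand_poly :: "(nat \<Rightarrow> 'a \<Rightarrow> complex) \<Rightarrow> nat \<Rightarrow> 'a \<Rightarrow> complex poly" where
  "rand_poly C n \<omega> = (\<Sum>k\<le>n. monom (C k \<omega>) k)"

(* The value at A of (1/n) * (sum of the point masses at the zeros of p, with multiplicity).
   The factor is 1/n rather than 1 / degree p; for rand_poly C n the two agree almost surely
   when C n has a density. *)
definition zero_counting :: "nat \<Rightarrow> complex poly \<Rightarrow> complex set \<Rightarrow> real" where
  "zero_counting n p A = (\<Sum>z\<in>#proots p. indicator A z) / real n"

(* Arg2pi is the argument with values in [0, 2 pi). *)
definition annular_sector :: "real \<Rightarrow> real \<Rightarrow> real \<Rightarrow> complex set" where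
  "annular_sector r \<alpha> \<beta> =
     {z. r < cmod z \<and> cmod z < 1 / r \<and> \<alpha> \<le> Arg2pi z \<and> Arg2pi z < \<beta>}"

(* Extended expectation E[X+] - E[X-]; ennreal truncates negative reals to 0.
   It is the usual expectation in [-\<infinity>, \<infinity>) whenever E[X+] is finite. *)
definition ext_expectation :: "'a measure \<Rightarrow> ('a \<Rightarrow> real) \<Rightarrow> ereal" where
  "ext_expectation M X =
     enn2ereal (\<integral>\<^sup>+\<omega>. ennreal (X \<omega>) \<partial>M) - enn2ereal (\<integral>\<^sup>+\<omega>. ennreal (- X \<omega>) \<partial>M)"

(* E[log |Z|]. The convention ln 0 = 0 is immaterial for Z with a density, where Z = 0 is a
   null event. *)
definition log_moment :: "'a measure \<Rightarrow> ('a \<Rightarrow> complex) \<Rightarrow> ereal" where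
  "log_moment M Z = ext_expectation M (\<lambda>\<omega>. ln (cmod (Z \<omega>)))"

(* sqrt ((log(n+1) - a/2 - b/2 + c) / n), read as \<infinity> if one of the log-moments a, b is -\<infinity>. *)
definition sqrt_term :: "nat \<Rightarrow> ereal \<Rightarrow> ereal \<Rightarrow> real \<Rightarrow> ereal" where
  "sqrt_term n a b c =
     (if a = -\<infinity> \<or> b = -\<infinity> then \<infinity>
      else ereal (sqrt ((ln (real n + 1) - real_of_ereal a / 2 - real_of_ereal b / 2 + c) / real n)))"

end

theory Submission
  imports
    Defs
    "HOL-Complex_Analysis.Complex_Analysis"
    "HOL-Computational_Algebra.Fundamental_Theorem_Algebra"
begin

text \<open>The theorem is the average over the sample space of a deterministic estimate. For a polynomial
  \<open>p\<close> of degree \<open>n\<close> with \<open>p 0 \<noteq> 0\<close>, let \<open>h\<close> be the logarithm of the sum of the moduli of its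
  coefficients divided by the geometric mean of the first and last of these moduli. The lemma
  \<open>erdos_turan_annular_sector\<close> bounds the discrepancy of the zeros in the sector by
  \<open>(\<surd>(2\<pi>/k) + 2/(1 - r)) \<surd>(h/n)\<close>. The expectation of \<open>h\<close> is bounded through the concavity of the
  logarithm, which gives \<open>log ((n + 1) \<mu>)\<close> for the coefficient sum, and the expectation of \<open>\<surd>h\<close>
  through the concavity of the square root. Thus \<open>log \<mu>\<close> serves as the bounded term.

  Write \<open>y = \<surd>(h/n)\<close>, \<open>\<kappa> = \<surd>(2\<pi>/k)\<close> and \<open>t = 2/(1 - r)\<close>. Two effects contribute to the deterministic
  estimate. Zeros outside the annulus are rare: by the maximum principle the product of
  \<open>max(\<bar>z\<bar>, 1/\<bar>z\<bar>)\<close> over the zeros is at most \<open>exp (2h)\<close>, so there are at most \<open>t h\<close> of them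
  (\<open>zeros_off_annulus_bound\<close>). The arguments of the zeros are equidistributed, by the theorem
  of Erdos and Turan; \<open>\<kappa>\<close> is the constant in the form that Ganelius gave to it. Here the angular
  constant is \<open>7/2\<close>, which the second term \<open>2/(1 - r)\<close> accommodates: the estimate is trivial unless \<open>(\<kappa> + t) y < 1\<close>. In that case the zeros outside the annulus
  contribute at most \<open>t y\<^sup>2 \<le> y\<close>, and since \<open>\<kappa> \<ge> 5/2\<close> and \<open>t \<ge> 2\<close>, an angular discrepancy of
  \<open>7/2 y\<close> is affordable, while \<open>y \<le> 2/9\<close> may be assumed.

  The angular estimate (\<open>erdos_turan_unit_circle\<close>) is proved as follows. Projecting the zeros radially
  to points \<open>w\<^sub>j\<close> of the unit circle does not increase the normalised maximum of \<open>\<bar>p\<bar>\<close>. So the analytic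
  function \<open>g(z) = \<Sum> Ln (1 - z w\<^sub>j)\<close> vanishes at the origin and has real part at most \<open>h\<close> in the
  disc. The inequality of Borel and Caratheodory then bounds its imaginary part on the circle of
  radius \<open>\<rho>\<close>. At the point \<open>exp (- 2 \<pi> \<i> u)\<close> of the unit circle the imaginary part is \<open>\<pi>\<close> times a sum
  \<open>E u\<close> of sawtooth functions whose increments are the discrepancies of arcs. On the circle of radius
  \<open>\<rho>\<close> it is \<open>\<pi>\<close> times the convolution of \<open>E\<close> with the Poisson kernel. The sum \<open>E\<close> decreases at most
  at rate \<open>n\<close>, so if it is large at a point, it stays large on an interval to the right. As the Poisson kernel
  has three quarters of its mass on a short interval, the oscillation of \<open>E\<close> is controlled by that of
  its convolution (\<open>sawtooth_sum_oscillation\<close>). The choice of \<open>\<rho>\<close> balances the two errors.\<close>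

section \<open>The Poisson kernel and the sawtooth function\<close>

text \<open>The Poisson kernel of the disc at radius \<open>\<rho>\<close>, on the circle parametrised by a variable of period 1.\<close>
definition poisson_kernel :: "real \<Rightarrow> real \<Rightarrow> real" where
  "poisson_kernel \<rho> t = (1 - \<rho>\<^sup>2) / (1 - 2 * \<rho> * cos (2 * pi * t) + \<rho>\<^sup>2)"

text \<open>The imaginary part of \<open>Ln (1 - \<rho> exp (2 \<pi> \<i> t))\<close> divided by \<open>\<pi>\<close> (see \<open>smooth_saw_eq_Im_Ln\<close>), written with
  the arctangent so that it can be differentiated as a real function. At \<open>\<rho> = 1\<close> it would be the
  sawtooth \<open>frac t - 1/2\<close>, away from the integers.\<close>
definition smooth_saw :: "real \<Rightarrow> real \<Rightarrow> real" where
  "smooth_saw \<rho> t = - arctan (\<rho> * sin (2 * pi * t) / (1 - \<rho> * cos (2 * pi * t))) / pi"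

lemma poisson_denominator_pos:
  fixes \<rho> x :: real
  assumes "0 \<le> \<rho>" "\<rho> < 1"
  shows "0 < 1 - \<rho> * cos x" and "0 < 1 - 2 * \<rho> * cos x + \<rho>\<^sup>2"
proof -
  have "\<rho> * cos x \<le> \<rho> * 1"
    by (intro mult_left_mono assms) simp
  then show "0 < 1 - \<rho> * cos x"
    using assms by linarith
  have "0 < (1 - \<rho>)\<^sup>2"
    using assms by simp
  then show "0 < 1 - 2 * \<rho> * cos x + \<rho>\<^sup>2"
    using \<open>\<rho> * cos x \<le> \<rho> * 1\<close> by (simp add: power2_eq_square algebra_simps)
qed

lemma poisson_kernel_nonneg:
  assumes "0 \<le> \<rho>" "\<rho> < 1"
  shows "0 \<le> poisson_kernel \<rho> t"
  unfolding poisson_kernel_def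
  using poisson_denominator_pos(2)[OF assms] assms
  by (intro divide_nonneg_pos) (auto simp: power_le_one)

lemma poisson_kernel_even: "poisson_kernel \<rho> (- t) = poisson_kernel \<rho> t"
  by (simp add: poisson_kernel_def)

lemma continuous_on_poisson_kernel:
  assumes "0 \<le> \<rho>" "\<rho> < 1"
  shows "continuous_on S (poisson_kernel \<rho>)"
proof -
  have "1 - 2 * \<rho> * cos (2 * pi * t) + \<rho>\<^sup>2 \<noteq> 0" for t
    using poisson_denominator_pos(2)[OF assms, of "2 * pi * t"] by simp
  then show ?thesis
    unfolding poisson_kernel_def by (intro continuous_intros) auto
qed

text \<open>Hence \<open>t - smooth_saw \<rho> t\<close> is a primitive of the Poisson kernel, which gives its mass on every
  interval.\<close>
lemma smooth_saw_deriv: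
  assumes "0 \<le> \<rho>" "\<rho> < 1"
  shows "(smooth_saw \<rho> has_real_derivative 1 - poisson_kernel \<rho> t) (at t)"
proof -
  define s where "s = sin (2 * pi * t)"
  define c where "c = cos (2 * pi * t)"
  define d where "d = 1 - \<rho> * c"
  have d: "0 < d"
    using poisson_denominator_pos(1)[OF assms] by (simp add: d_def c_def)
  have sc: "s * s = 1 - c * c"
    using sin_squared_eq[of "2 * pi * t"] by (simp add: s_def c_def power2_eq_square)
  have e: "d * d + (\<rho> * s) * (\<rho> * s) = 1 - 2 * \<rho> * c + \<rho>\<^sup>2"
  proof -
    have "d * d + (\<rho> * s) * (\<rho> * s) = d * d + \<rho> * \<rho> * (s * s)"
      by simp
    also have "\<dots> = 1 - 2 * \<rho> * c + \<rho>\<^sup>2"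
      unfolding sc by (simp add: d_def power2_eq_square algebra_simps)
    finally show ?thesis .
  qed
  have pos: "0 < 1 - 2 * \<rho> * c + \<rho>\<^sup>2"
    using poisson_denominator_pos(2)[OF assms] by (simp add: c_def)
  have "(smooth_saw \<rho> has_real_derivative
     - (((\<rho> * (c * (2 * pi))) * d - \<rho> * s * (\<rho> * (s * (2 * pi)))) / (d * d)
          * inverse (1 + (\<rho> * s / d)\<^sup>2)) / pi) (at t)"
    unfolding smooth_saw_def s_def c_def d_def
    using d by (auto intro!: derivative_eq_intros simp: d_def c_def s_def ac_simps)
  moreover have "- (((\<rho> * (c * (2 * pi))) * d - \<rho> * s * (\<rho> * (s * (2 * pi)))) / (d * d)
          * inverse (1 + (\<rho> * s / d)\<^sup>2)) / pi = 1 - poisson_kernel \<rho> t"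
  proof -
    have "(d * d) * (1 + (\<rho> * s / d)\<^sup>2) = 1 - 2 * \<rho> * c + \<rho>\<^sup>2"
      unfolding e[symmetric] using d by (simp add: power2_eq_square field_simps)
    have *: "- (x / (d * d) * y) / pi = - x * (inverse (d * d) * y) / pi" for x y
      by (simp add: divide_inverse mult.assoc)
    from \<open>(d * d) * _ = _\<close> have "inverse (d * d) * inverse (1 + (\<rho> * s / d)\<^sup>2) = inverse (1 - 2 * \<rho> * c + \<rho>\<^sup>2)"
      by (metis inverse_mult_distrib)
    then have "- (((\<rho> * (c * (2 * pi))) * d - \<rho> * s * (\<rho> * (s * (2 * pi)))) / (d * d)
          * inverse (1 + (\<rho> * s / d)\<^sup>2)) / pi
      = - ((\<rho> * (c * (2 * pi))) * d - \<rho> * s * (\<rho> * (s * (2 * pi)))) * inverse (1 - 2 * \<rho> * c + \<rho>\<^sup>2) / pi"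
      by (simp only: *)
    also have "\<dots> = - (2 * (\<rho> * c * d - \<rho> * \<rho> * (s * s))) / (1 - 2 * \<rho> * c + \<rho>\<^sup>2)"
    proof -
      have "- ((\<rho> * (c * (2 * pi))) * d - \<rho> * s * (\<rho> * (s * (2 * pi)))) = - (2 * (\<rho> * c * d - \<rho> * \<rho> * (s * s))) * pi"
        by (simp add: algebra_simps)
      then show ?thesis
        by (simp only: divide_inverse) simp
    qed
    also have "\<dots> = 1 - poisson_kernel \<rho> t"
      unfolding poisson_kernel_def c_def[symmetric] sc
      using pos by (simp add: field_simps d_def power2_eq_square)
    finally show ?thesis .
  qed
  ultimately show ?thesis
    by simp
qed

lemma poisson_kernel_has_integral:
  assumes "0 \<le> \<rho>" "\<rho> < 1" "a \<le> b"
  shows "(poisson_kernel \<rho> has_integral (b - smooth_saw \<rho> b) - (a - smooth_saw \<rho> a)) {a..b}"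
  using assms(3)
proof (rule fundamental_theorem_of_calculus)
  fix x
  have "((\<lambda>t. t - smooth_saw \<rho> t) has_real_derivative 1 - (1 - poisson_kernel \<rho> x)) (at x)"
    by (intro DERIV_diff DERIV_ident smooth_saw_deriv assms)
  then show "((\<lambda>t. t - smooth_saw \<rho> t) has_vector_derivative poisson_kernel \<rho> x) (at x within {a..b})"
    by (simp add: has_real_derivative_iff_has_vector_derivative has_vector_derivative_at_within)
qed

lemma id_mult_poisson_kernel_has_integral:
  assumes "0 \<le> \<rho>" "\<rho> < 1"
  shows "((\<lambda>s. s * poisson_kernel \<rho> s) has_integral 0) {-a..a}"
proof -
  have "(\<lambda>s. s * poisson_kernel \<rho> s) integrable_on {-a..a}"
    by (intro integrable_continuous_interval continuous_intros continuous_on_poisson_kernel assms)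
  then obtain i where i: "((\<lambda>s. s * poisson_kernel \<rho> s) has_integral i) {-a..a}"
    by blast
  have "((\<lambda>s. - s * poisson_kernel \<rho> (- s)) has_integral i) {-a..- (-a)}"
    by (subst has_integral_reflect_real) (use i in auto)
  then have "((\<lambda>s. - (s * poisson_kernel \<rho> s)) has_integral i) {-a..a}"
    by (simp add: poisson_kernel_even)
  from has_integral_neg[OF this] have "((\<lambda>s. s * poisson_kernel \<rho> s) has_integral - i) {-a..a}"
    by simp
  with i have "i = - i"
    using has_integral_unique by blast
  with i show ?thesis
    by simp
qed

lemma smooth_saw_periodic: "smooth_saw \<rho> (t + of_int k) = smooth_saw \<rho> t"
proof -
  have "2 * pi * (t + of_int k) = 2 * pi * t + 2 * pi * of_int k"
    by (simp add: algebra_simps)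
  moreover have "sin (2 * pi * t + 2 * pi * of_int k) = sin (2 * pi * t)"
      "cos (2 * pi * t + 2 * pi * of_int k) = cos (2 * pi * t)"
    by (simp_all only: sin_add cos_add sin_int_2pin cos_int_2pin mult_1_right mult_zero_right add_0_right diff_0_right)
  ultimately show ?thesis
    by (simp only: smooth_saw_def)
qed

text \<open>For \<open>t\<close> and \<open>s\<close> in one period, \<open>frac (t - s)\<close> is \<open>t - s\<close>, plus 1 when \<open>t < s\<close>. The linear part
  integrates to \<open>t - 1/2\<close> because the kernel is even of mass 1, and the jump contributes the mass of the
  kernel on the interval from \<open>t\<close> to \<open>1/2\<close>, which the primitive evaluates.\<close>
lemma sawtooth_convolution_aux:
  assumes "0 \<le> \<rho>" "\<rho> < 1" "- 1/2 \<le> t" "t < 1/2"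
  shows "((\<lambda>s. (frac (t - s) - 1/2) * poisson_kernel \<rho> s) has_integral smooth_saw \<rho> t) {-1/2..1/2}"
proof -
  let ?P = "poisson_kernel \<rho>"
  have half: "smooth_saw \<rho> (1/2) = 0" "smooth_saw \<rho> (- 1/2) = 0"
    by (simp_all add: smooth_saw_def)
  have 1: "(?P has_integral 1) {-1/2..1/2}"
    using poisson_kernel_has_integral[OF assms(1,2), of "-1/2" "1/2"] half by simp
  have 2: "((\<lambda>s. s * ?P s) has_integral 0) {-1/2..1/2}"
    using id_mult_poisson_kernel_has_integral[OF assms(1,2), of "1/2"] by simp
  have 3: "((\<lambda>s. if t < s then ?P s else 0) has_integral 0 + (1/2 - (t - smooth_saw \<rho> t))) {-1/2..1/2}"
  proof (rule has_integral_combine[where c = t])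
    show "((\<lambda>s. if t < s then ?P s else 0) has_integral 0) {-1/2..t}"
      by (rule has_integral_eq[OF _ has_integral_0]) auto
    have "(?P has_integral 1/2 - (t - smooth_saw \<rho> t)) {t..1/2}"
      using poisson_kernel_has_integral[OF assms(1,2), of t "1/2"] assms(4) half by simp
    then show "((\<lambda>s. if t < s then ?P s else 0) has_integral 1/2 - (t - smooth_saw \<rho> t)) {t..1/2}"
      by (rule has_integral_spike_finite[rotated 2, where S = "{t}"]) auto
  qed (use assms in auto)
  have "((\<lambda>s. (t - 1/2) * ?P s - s * ?P s + (if t < s then ?P s else 0)) has_integral
      (t - 1/2) * 1 - 0 + (0 + (1/2 - (t - smooth_saw \<rho> t)))) {-1/2..1/2}"
    by (intro has_integral_add has_integral_diff has_integral_mult_right 1 2 3)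
  then have "((\<lambda>s. (t - 1/2) * ?P s - s * ?P s + (if t < s then ?P s else 0)) has_integral
      smooth_saw \<rho> t) {-1/2..1/2}"
    by simp
  then show ?thesis
  proof (rule has_integral_eq[rotated])
    fix s :: real
    assume s: "s \<in> {-1/2..1/2}"
    have "frac (t - s) = t - s + (if t < s then 1 else 0)"
      unfolding frac_unique_iff using s assms by auto
    then show "(t - 1/2) * ?P s - s * ?P s + (if t < s then ?P s else 0) = (frac (t - s) - 1/2) * ?P s"
      unfolding \<open>frac (t - s) = _\<close> by (simp add: algebra_simps)
  qed
qed

lemma sawtooth_convolution:
  assumes "0 \<le> \<rho>" "\<rho> < 1"
  shows "((\<lambda>s. (frac (t - s) - 1/2) * poisson_kernel \<rho> s) has_integral smooth_saw \<rho> t) {-1/2..1/2}"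
proof -
  define k where "k = \<lfloor>t + 1/2\<rfloor>"
  define u where "u = t - of_int k"
  have u: "- 1/2 \<le> u" "u < 1/2"
    unfolding u_def k_def by linarith+
  have t: "t = u + of_int k"
    by (simp add: u_def)
  have "frac (t - s) = frac (u - s)" for s
  proof -
    have "u + of_int k - s = (u - s) + of_int k"
      by simp
    then show ?thesis
      unfolding t by (simp only: frac_add_of_int_right)
  qed
  then show ?thesis
    using sawtooth_convolution_aux[OF assms u] by (simp add: t smooth_saw_periodic)
qed

lemma smooth_saw_odd: "smooth_saw \<rho> (- t) = - smooth_saw \<rho> t"
  by (simp add: smooth_saw_def arctan_minus)

text \<open>With \<open>\<rho> = (c - 1)/(c + 1)\<close>, the primitive of the Poisson kernel is \<open>arctan (c tan (\<pi> t)) / \<pi>\<close>, so the mass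
  on \<open>[-\<delta>, \<delta>]\<close> is at least \<open>3/4\<close> as soon as \<open>c tan (\<pi> \<delta>)\<close> reaches \<open>tan (3 \<pi>/8)\<close>. The proof compares
  tangents instead of establishing the closed form.\<close>
lemma poisson_kernel_core_mass:
  assumes c: "1 \<le> c" and \<delta>: "0 < \<delta>" "\<delta> < 1/2"
    and tan: "tan (3 * pi / 8) \<le> c * tan (pi * \<delta>)"
  shows "3/8 \<le> \<delta> - smooth_saw ((c - 1) / (c + 1)) \<delta>"
proof -
  define \<phi> where "\<phi> = pi * \<delta>"
  define q where "q = tan (3 * pi / 8)"
  define t where "t = tan \<phi>"
  have \<phi>: "0 < \<phi>" "\<phi> < pi / 2"
    using \<delta> by (auto simp: \<phi>_def)
  have cos: "0 < cos \<phi>"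
    using \<phi> by (intro cos_gt_zero) auto
  have t: "0 < t"
    unfolding t_def using \<phi> by (rule tan_gt_zero)
  have q: "0 < q"
    unfolding q_def by (rule tan_gt_zero) auto
  have cosq: "cos (3 * pi / 8) \<noteq> 0"
    using cos_gt_zero[of "3 * pi / 8"] by simp
  have sn: "sin \<phi> = t * cos \<phi>"
    using cos by (simp add: t_def tan_def)
  \<comment> \<open>\<open>X\<close> is the argument of the arctangent in \<open>smooth_saw\<close>; in terms of \<open>t = tan (\<pi> \<delta>)\<close> it equals
    \<open>(c t - t) / (1 + c t\<^sup>2)\<close>, the tangent of \<open>arctan (c t) - \<pi> \<delta>\<close>.\<close>
  define X where "X = (c - 1) / (c + 1) * sin (2 * pi * \<delta>) / (1 - (c - 1) / (c + 1) * cos (2 * pi * \<delta>))"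
  have X: "X = (c * t - t) / (1 + c * t * t)"
  proof -
    have one: "(1::real) = cos \<phi> * cos \<phi> * (1 + t * t)"
      using sin_cos_squared_add[of \<phi>] sn by (simp add: power2_eq_square algebra_simps)
    have s2: "sin (2 * pi * \<delta>) = cos \<phi> * cos \<phi> * (2 * t)"
      using sin_double[of \<phi>] sn by (simp add: \<phi>_def mult.assoc)
    have c2: "cos (2 * pi * \<delta>) = cos \<phi> * cos \<phi> * (1 - t * t)"
      using cos_double[of \<phi>] sn by (simp add: \<phi>_def mult.assoc power2_eq_square algebra_simps)
    have "X = ((c - 1) * sin (2 * pi * \<delta>)) / ((c + 1) * (1 - (c - 1) / (c + 1) * cos (2 * pi * \<delta>)))"
      unfolding X_def using c by simp
    also have "(c + 1) * (1 - (c - 1) / (c + 1) * cos (2 * pi * \<delta>)) = (c + 1) * 1 - (c - 1) * cos (2 * pi * \<delta>)"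
      using c by (simp add: right_diff_distrib)
    also have "\<dots> = (c + 1) * (cos \<phi> * cos \<phi> * (1 + t * t)) - (c - 1) * (cos \<phi> * cos \<phi> * (1 - t * t))"
      using one c2 by simp
    also have "\<dots> = (cos \<phi> * cos \<phi> * 2) * (1 + c * t * t)"
      by (simp add: algebra_simps)
    also have "(c - 1) * sin (2 * pi * \<delta>) = (cos \<phi> * cos \<phi> * 2) * (c * t - t)"
      unfolding s2 by (simp add: algebra_simps)
    finally show ?thesis
      using cos by simp
  qed
  have "tan (3 * pi / 8 - \<phi>) = (q - t) / (1 + q * t)"
    unfolding q_def t_def
    by (rule tan_diff) (use cos cosq \<phi> cos_gt_zero_pi[of "3 * pi / 8 - \<phi>"] in auto)
  also have "\<dots> \<le> X"
  proof -
    have "(q - c * t) * (1 + t * t) \<le> 0"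
      using tan by (intro mult_nonpos_nonneg) (auto simp: q_def t_def \<phi>_def)
    then have "(q - t) * (1 + c * t * t) \<le> (c * t - t) * (1 + q * t)"
      by (simp add: algebra_simps)
    moreover have "0 < 1 + q * t" "0 < 1 + c * t * t"
      using q t c by (auto intro!: add_pos_nonneg)
    ultimately show ?thesis
      unfolding X by (simp add: divide_le_eq pos_le_divide_eq mult.commute)
  qed
  finally have "arctan (tan (3 * pi / 8 - \<phi>)) \<le> arctan X"
    by (rule arctan_monotone')
  also have "arctan (tan (3 * pi / 8 - \<phi>)) = 3 * pi / 8 - \<phi>"
    using \<phi> by (intro arctan_tan) auto
  finally have "3 * pi / 8 \<le> pi * \<delta> + arctan X"
    by (simp add: \<phi>_def)
  then have "3 * pi / 8 / pi \<le> (pi * \<delta> + arctan X) / pi"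
    by (intro divide_right_mono) auto
  then show ?thesis
    by (simp add: smooth_saw_def X_def add_divide_distrib)
qed

section \<open>Recovering the oscillation of a function from its convolution\<close>

text \<open>The function is at least \<open>F u - N (\<delta> + s)\<close> at the points \<open>u + \<delta> + s\<close> with \<open>\<bar>s\<bar> \<le> \<delta>\<close>, and at least \<open>m\<close>
  elsewhere. The term linear in \<open>s\<close> integrates to zero, which is why the window is centred at \<open>u + \<delta>\<close>.\<close>
lemma smoothing_lower_bound:
  fixes F P :: "real \<Rightarrow> real"
  assumes slope: "\<And>u r. 0 \<le> r \<Longrightarrow> F u - N * r \<le> F (u + r)"
    and lower: "\<And>u. m \<le> F u"
    and P: "\<And>s. 0 \<le> P s" "(P has_integral 1) {-1/2..1/2}"
    and core: "(P has_integral p) {-\<delta>..\<delta>}" "((\<lambda>s. s * P s) has_integral 0) {-\<delta>..\<delta>}"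
    and \<delta>: "0 \<le> \<delta>" "\<delta> \<le> 1/2"
    and I: "((\<lambda>s. F (u + \<delta> + s) * P s) has_integral I) {-1/2..1/2}"
  shows "m + (F u - m - N * \<delta>) * p \<le> I"
proof -
  have "((\<lambda>s. (F u - m - N * \<delta>) * P s - N * (s * P s)) has_integral (F u - m - N * \<delta>) * p - N * 0) {-\<delta>..\<delta>}"
    by (intro has_integral_diff has_integral_mult_right core)
  then have "((\<lambda>s. if s \<in> {-\<delta>..\<delta>} then (F u - m - N * \<delta>) * P s - N * (s * P s) else 0)
      has_integral (F u - m - N * \<delta>) * p) {-1/2..1/2}"
    by (subst has_integral_restrict) (use \<delta> in auto)
  from has_integral_add[OF has_integral_mult_right[OF P(2), of m] this]
  have low: "((\<lambda>s. m * P s + (if s \<in> {-\<delta>..\<delta>} then (F u - m - N * \<delta>) * P s - N * (s * P s) else 0))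
      has_integral m + (F u - m - N * \<delta>) * p) {-1/2..1/2}"
    by simp
  show ?thesis
  proof (rule has_integral_le[OF low I])
    fix s :: real
    show "m * P s + (if s \<in> {-\<delta>..\<delta>} then (F u - m - N * \<delta>) * P s - N * (s * P s) else 0)
        \<le> F (u + \<delta> + s) * P s"
    proof (cases "s \<in> {-\<delta>..\<delta>}")
      case True
      then have "F u - N * (\<delta> + s) \<le> F (u + (\<delta> + s))"
        by (intro slope) auto
      then have "(F u - N * (\<delta> + s)) * P s \<le> F (u + (\<delta> + s)) * P s"
        by (rule mult_right_mono) (rule P)
      with True show ?thesis
        by (simp add: algebra_simps)
    next
      case False
      then show ?thesis
        using mult_right_mono[OF lower P(1)] by (simp only: False if_False add_0_right)
    qed
  qed
qed

text \<open>Let \<open>M\<close> and \<open>m\<close> be the supremum and infimum of \<open>E\<close>, and \<open>p\<close> the mass of the kernel on \<open>[-\<delta>, \<delta>]\<close>.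
  A one-sided average near a point where \<open>E\<close> is almost \<open>M\<close>, and one near a point where \<open>E\<close> is almost \<open>m\<close>,
  differ by at least \<open>(2p - 1)(M - m) - 2 N \<delta> p\<close>, where \<open>N\<close> is the number of terms; on the other hand
  they differ by at most \<open>2B\<close>. Since \<open>p \<ge> 3/4\<close>, this bounds \<open>M - m\<close>.\<close>
lemma sawtooth_sum_oscillation:
  fixes x :: "'i \<Rightarrow> real" and E :: "real \<Rightarrow> real" and \<rho> \<delta> B :: real
  assumes E_def: "\<And>y. E y = (\<Sum>j\<in>J. (frac (x j - y) - 1/2))"
    and J: "finite J" and \<rho>: "0 \<le> \<rho>" "\<rho> < 1"
    and \<delta>: "0 < \<delta>" "\<delta> < 1/2" "3/8 \<le> \<delta> - smooth_saw \<rho> \<delta>"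
    and B: "\<And>y. \<bar>\<Sum>j\<in>J. smooth_saw \<rho> (x j - y)\<bar> \<le> B"
  shows "E a - E b \<le> 3 * real (card J) * \<delta> + 4 * B"
proof -
  define N where "N = real (card J)"
  define P where "P = poisson_kernel \<rho>"
  define F where "F = E"
  define I where "I y = (\<Sum>j\<in>J. smooth_saw \<rho> (x j - y))" for y
  define p where "p = 2 * (\<delta> - smooth_saw \<rho> \<delta>)"
  have p: "3/4 \<le> p"
    using \<delta> by (simp add: p_def)
  have half: "smooth_saw \<rho> (1/2) = 0"
    by (simp add: smooth_saw_def)
  have P: "\<And>s. 0 \<le> P s" "(P has_integral 1) {-1/2..1/2}" "(P has_integral p) {-\<delta>..\<delta>}"
      "((\<lambda>s. s * P s) has_integral 0) {-\<delta>..\<delta>}"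
    using poisson_kernel_nonneg[OF \<rho>] poisson_kernel_has_integral[OF \<rho>, of "-1/2" "1/2"]
      poisson_kernel_has_integral[OF \<rho>, of "-\<delta>" "\<delta>"] \<delta> half smooth_saw_odd[of \<rho> "1/2"]
      id_mult_poisson_kernel_has_integral[OF \<rho>, of \<delta>]
    by (auto simp: P_def p_def smooth_saw_odd)
  have conv: "((\<lambda>s. F (y + s) * P s) has_integral I y) {-1/2..1/2}" for y
  proof -
    have "((\<lambda>s. \<Sum>j\<in>J. (frac ((x j - y) - s) - 1/2) * P s) has_integral I y) {-1/2..1/2}"
      unfolding I_def P_def by (intro has_integral_sum J sawtooth_convolution \<rho>)
    then show ?thesis
      by (simp add: F_def E_def sum_distrib_right diff_diff_eq)
  qed
  have slope: "F u - N * r \<le> F (u + r)" if "0 \<le> r" for u r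
  proof -
    have "F u - N * r = (\<Sum>j\<in>J. (frac (x j - u) - 1/2) - r)"
      by (simp add: F_def E_def N_def sum_subtractf)
    also have "\<dots> \<le> F (u + r)"
      unfolding F_def E_def
    proof (rule sum_mono)
      fix j
      have "\<lfloor>x j - (u + r)\<rfloor> \<le> \<lfloor>x j - u\<rfloor>"
        using that by (intro floor_mono) simp
      then show "frac (x j - u) - 1/2 - r \<le> frac (x j - (u + r)) - 1/2"
        by (simp add: frac_def)
    qed
    finally show ?thesis .
  qed
  have bd: "\<bar>F u\<bar> \<le> N" for u
  proof -
    have "\<bar>F u\<bar> \<le> (\<Sum>j\<in>J. \<bar>frac (x j - u) - 1/2\<bar>)"
      unfolding F_def E_def by (rule sum_abs)
    also have "\<dots> \<le> (\<Sum>j\<in>J. 1)"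
    proof (rule sum_mono)
      fix j show "\<bar>frac (x j - u) - 1/2\<bar> \<le> 1"
        using frac_ge_0[of "x j - u"] frac_lt_1[of "x j - u"] by linarith
    qed
    finally show ?thesis
      by (simp add: N_def)
  qed
  have bdd: "bdd_above (range F)" "bdd_below (range F)"
    using bd by (auto intro!: bdd_aboveI[of _ N] bdd_belowI[of _ "- N"] simp: abs_le_iff minus_le_iff)
  define M where "M = (SUP u. F u)"
  define m where "m = (INF u. F u)"
  have FM: "F u \<le> M" and Fm: "m \<le> F u" for u
    unfolding M_def m_def by (auto intro: cSUP_upper cINF_lower bdd)
  have key: "p * F u \<le> 2 * B + 2 * N * \<delta> * p + (M - m) * (1 - p) + p * F v" for u v
  proof -
    have "m + (F u - m - N * \<delta>) * p \<le> I (u + \<delta>)"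
      by (rule smoothing_lower_bound[OF slope Fm P(1,2,3,4)]) (use \<delta> conv in auto)
    \<comment> \<open>The upper bound at \<open>v\<close> is the lower bound for the reflected function \<open>x \<mapsto> - F (- x)\<close>, which
      decreases at most at the same rate.\<close>
    moreover have "- M + (- F (- (- v)) - (- M) - N * \<delta>) * p \<le> - I (v - \<delta>)"
    proof (rule smoothing_lower_bound[where F = "\<lambda>x. - F (- x)" and P = P])
      show "- F (- w) - N * r \<le> - F (- (w + r))" if "0 \<le> r" for w r
        using slope[OF that, of "- (w + r)"] by simp
      have "((\<lambda>s. F (v - \<delta> + - s) * P (- s)) has_integral I (v - \<delta>)) {-1/2..- (-1/2)}"
        using has_integral_reflect_real[of "\<lambda>s. F (v - \<delta> + s) * P s" "I (v - \<delta>)" "1/2" "- 1/2"] conv[of "v - \<delta>"]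
        by simp
      then have "((\<lambda>s. - (F (v - \<delta> + - s) * P s)) has_integral - I (v - \<delta>)) {-1/2..1/2}"
        by (intro has_integral_neg) (simp add: P_def poisson_kernel_even)
      then show "((\<lambda>s. - F (- (- v + \<delta> + s)) * P s) has_integral - I (v - \<delta>)) {-1/2..1/2}"
        by (simp add: algebra_simps)
    qed (use FM P \<delta> in auto)
    moreover have "I (u + \<delta>) \<le> B" "- I (v - \<delta>) \<le> B"
      using B by (auto simp: I_def abs_le_iff)
    ultimately show ?thesis
      by (simp add: algebra_simps)
  qed
  have pos: "0 < p"
    using p by simp
  have "p * M \<le> 2 * B + 2 * N * \<delta> * p + (M - m) * (1 - p) + p * F v" for v
  proof -
    have "M \<le> (2 * B + 2 * N * \<delta> * p + (M - m) * (1 - p) + p * F v) / p"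
      unfolding M_def using key[of _ v] pos
      by (intro cSUP_least) (auto simp: pos_le_divide_eq mult.commute M_def[symmetric])
    then show ?thesis
      using pos by (simp add: pos_le_divide_eq mult.commute)
  qed
  then have "(p * M - (2 * B + 2 * N * \<delta> * p + (M - m) * (1 - p))) / p \<le> F v" for v
    using pos by (simp add: pos_divide_le_eq mult.commute algebra_simps)
  then have "(p * M - (2 * B + 2 * N * \<delta> * p + (M - m) * (1 - p))) / p \<le> m"
    unfolding m_def by (intro cINF_greatest) auto
  then have D: "(2 * p - 1) * (M - m) \<le> 2 * N * \<delta> * p + 2 * B"
    using pos by (simp add: pos_divide_le_eq algebra_simps)
  have "0 \<le> B"
    using B[of 0] by linarith
  have "2 * N * \<delta> * p + 2 * B \<le> (2 * p - 1) * (3 * N * \<delta> + 4 * B)"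
  proof -
    have "0 \<le> (N * \<delta>) * (4 * p - 3)" "0 \<le> B * (8 * p - 6)"
      using p \<delta> \<open>0 \<le> B\<close> by (auto simp: N_def)
    then show ?thesis
      by (simp add: algebra_simps)
  qed
  with D have "(2 * p - 1) * (M - m) \<le> (2 * p - 1) * (3 * N * \<delta> + 4 * B)"
    by linarith
  then have "M - m \<le> 3 * N * \<delta> + 4 * B"
    using p by (simp add: mult_le_cancel_left_pos)
  then show ?thesis
    using FM[of a] Fm[of b] by (simp add: F_def N_def)
qed

section \<open>Analytic functions with bounded real part\<close>

lemma norm_le_on_disc_of_le_on_circle:
  assumes "f holomorphic_on ball 0 1" "continuous_on (cball 0 1) f"
    and "\<And>z. cmod z = 1 \<Longrightarrow> cmod (f z) \<le> B" and "cmod z < 1"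
  shows "cmod (f z) \<le> B"
  by (rule maximum_modulus_frontier[where S = "ball 0 1"]) (use assms in auto)

text \<open>The map \<open>u \<mapsto> u / (2A - u)\<close> takes the half plane \<open>Re u < A\<close> into the unit disc and fixes 0, so the Schwarz
  lemma applies to its composition with \<open>g\<close>. As \<open>Re g = A\<close> is allowed, the argument is run with a
  slightly larger \<open>A'\<close>.\<close>
lemma borel_caratheodory_at_zero:
  assumes hol: "g holomorphic_on ball 0 1" and "g 0 = 0"
    and Re: "\<And>z. cmod z < 1 \<Longrightarrow> Re (g z) \<le> A" and z: "cmod z < 1"
  shows "cmod (g z) \<le> 2 * A * cmod z / (1 - cmod z)"
proof -
  define K where "K = 2 * cmod z / (1 - cmod z)"
  have K: "0 \<le> K"
    using z by (simp add: K_def)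
  have A0: "0 \<le> A"
    using Re[of 0] assms(2) by simp
  have "cmod (g z) \<le> A * K + e" if e: "0 < e" for e
  proof -
    define A' where "A' = A + e / (K + 1)"
    have A': "A < A'"
      using e K by (simp add: A'_def)
    define f where "f w = g w / (2 * A' - g w)" for w
    have ne: "2 * of_real A' - g w \<noteq> 0" if "cmod w < 1" for w
    proof
      assume "2 * of_real A' - g w = 0"
      then have "Re (2 * of_real A' - g w) = Re 0"
        by simp
      then show False
        using Re[OF that] A' A0 by simp
    qed
    have "cmod (f z) \<le> cmod z"
    proof (rule Schwarz_Lemma(1)[OF _ _ _ z])
      show "f holomorphic_on ball 0 1"
        unfolding f_def using ne by (intro holomorphic_intros hol) auto
      show "f 0 = 0"
        by (simp add: f_def assms(2))
      fix w :: complex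
      assume w: "cmod w < 1"
      have "(cmod (g w))\<^sup>2 < (cmod (2 * of_real A' - g w))\<^sup>2"
      proof -
        have "0 < 4 * A' * (A' - Re (g w))"
          using Re[OF w] A' A0 by (intro mult_pos_pos) auto
        then show ?thesis
          unfolding cmod_power2 by (simp add: power2_eq_square algebra_simps)
      qed
      then have "cmod (g w) < cmod (2 * of_real A' - g w)"
        using power2_less_imp_less norm_ge_zero by blast
      then show "cmod (f w) < 1"
        unfolding f_def norm_divide by (subst pos_divide_less_eq) (use ne[OF w] in auto)
    qed
    then have "cmod (g z) \<le> cmod z * cmod (2 * of_real A' - g z)"
      using ne[OF z] by (simp add: f_def norm_divide pos_divide_le_eq)
    also have "\<dots> \<le> cmod z * (2 * A' + cmod (g z))"
      using A' A0 by (intro mult_left_mono order.trans[OF norm_triangle_ineq4]) auto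
    finally have "cmod (g z) \<le> A' * K"
      using z by (simp add: K_def field_simps)
    also have "\<dots> = A * K + e * (K / (K + 1))"
      by (simp add: A'_def algebra_simps)
    also have "\<dots> \<le> A * K + e"
      using K e by (intro add_left_mono mult_left_le) (auto simp: divide_le_eq)
    finally show ?thesis .
  qed
  then have "cmod (g z) \<le> A * K"
    by (rule field_le_epsilon)
  then show ?thesis
    by (simp add: K_def mult_ac)
qed

text \<open>The real part of the sum is the logarithm of \<open>\<Prod> \<bar>1 - z w\<^sub>j\<bar>\<close>. On the unit circle this product is
  the one in the hypothesis taken at the conjugate of \<open>z\<close>, hence by the maximum principle it is at
  most \<open>exp A\<close> in the disc.\<close>
lemma sum_Ln_bound:
  fixes w :: "'i \<Rightarrow> complex"
  assumes J: "finite J" and w: "\<And>j. j \<in> J \<Longrightarrow> cmod (w j) = 1"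
    and bound: "\<And>z. cmod z = 1 \<Longrightarrow> (\<Prod>j\<in>J. cmod (z - w j)) \<le> exp A"
    and z: "cmod z < 1"
  shows "cmod (\<Sum>j\<in>J. Ln (1 - z * w j)) \<le> 2 * A * cmod z / (1 - cmod z)"
proof (rule borel_caratheodory_at_zero[OF _ _ _ z])
  have Re: "0 < Re (1 - u * w j)" if "cmod u < 1" "j \<in> J" for u j
    using complex_Re_le_cmod[of "u * w j"] that w by (simp add: norm_mult)
  have ne: "1 - u * w j \<noteq> 0" if "cmod u < 1" "j \<in> J" for u j
    using Re[OF that] by (metis order_less_irrefl zero_complex.simps(1))
  show "(\<lambda>z. \<Sum>j\<in>J. Ln (1 - z * w j)) holomorphic_on ball 0 1"
    using Re by (intro holomorphic_intros) (auto simp: complex_nonpos_Reals_iff not_le)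
  show "(\<Sum>j\<in>J. Ln (1 - 0 * w j)) = 0"
    by simp
  fix u :: complex
  assume u: "cmod u < 1"
  have "cmod (\<Prod>j\<in>J. 1 - u * w j) \<le> exp A"
  proof (rule norm_le_on_disc_of_le_on_circle[OF _ _ _ u])
    show "(\<lambda>u. \<Prod>j\<in>J. 1 - u * w j) holomorphic_on ball 0 1"
      by (intro holomorphic_intros)
    show "continuous_on (cball 0 1) (\<lambda>u. \<Prod>j\<in>J. 1 - u * w j)"
      by (intro continuous_intros)
    fix v :: complex
    assume v: "cmod v = 1"
    have "cmod (1 - v * w j) = cmod (cnj v - w j)" for j
    proof -
      have "v * cnj v = 1"
        using v by (simp add: complex_norm_square[symmetric])
      then have "1 - v * w j = v * (cnj v - w j)"
        by (simp add: algebra_simps)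
      then show ?thesis
        using v by (simp add: norm_mult)
    qed
    then show "cmod (\<Prod>j\<in>J. 1 - v * w j) \<le> exp A"
      using bound[of "cnj v"] v by (simp add: prod_norm[symmetric])
  qed
  then have "(\<Prod>j\<in>J. exp (Re (Ln (1 - u * w j)))) \<le> exp A"
    using ne[OF u] by (simp add: prod_norm[symmetric])
  then show "Re (\<Sum>j\<in>J. Ln (1 - u * w j)) \<le> A"
    by (simp add: exp_sum[OF J, symmetric])
qed

section \<open>Equidistribution of points on the unit circle\<close>

lemma smooth_saw_eq_Im_Ln:
  assumes "0 \<le> \<rho>" "\<rho> < 1"
  shows "smooth_saw \<rho> t = Im (Ln (1 - of_real \<rho> * cis (2 * pi * t))) / pi"
proof -
  have "0 < Re (1 - of_real \<rho> * cis (2 * pi * t))"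
    using poisson_denominator_pos(1)[OF assms] by simp
  moreover from this have "1 - of_real \<rho> * cis (2 * pi * t) \<noteq> 0"
    by (metis order_less_irrefl zero_complex.simps(1))
  ultimately have "Im (Ln (1 - of_real \<rho> * cis (2 * pi * t)))
      = arctan (Im (1 - of_real \<rho> * cis (2 * pi * t)) / Re (1 - of_real \<rho> * cis (2 * pi * t)))"
    by (subst Im_Ln_eq) auto
  then show ?thesis
    by (simp add: smooth_saw_def arctan_minus)
qed

text \<open>The double angle formula at \<open>3 \<pi>/4\<close> gives \<open>(q - 1)\<^sup>2 = 2\<close> for \<open>q = tan (3 \<pi>/8)\<close>, and \<open>q\<close> is positive.\<close>
lemma tan_three_eighths_pi: "tan (3 * pi / 8) = 1 + sqrt 2"
proof -
  define q where "q = tan (3 * pi / 8)"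
  have q: "0 < q"
    unfolding q_def by (rule tan_gt_zero) auto
  have c1: "cos (3 * pi / 8) \<noteq> 0"
    using cos_gt_zero[of "3 * pi / 8"] by simp
  have e: "3 * pi / 4 = pi - pi / 4"
    by simp
  have c2: "cos (3 * pi / 4) \<noteq> 0" and t: "tan (3 * pi / 4) = - 1"
    unfolding e tan_def cos_diff sin_diff cos_45 sin_45 by simp_all
  have "tan (2 * (3 * pi / 8)) = 2 * q / (1 - q\<^sup>2)"
    unfolding q_def using c1 c2 by (intro tan_double) auto
  then have "2 * q / (1 - q\<^sup>2) = - 1"
    using t by simp
  then have "2 * q = - (1 - q\<^sup>2)"
    using q by (cases "1 - q\<^sup>2 = 0") (auto simp: divide_eq_eq)
  then have "(q - 1)\<^sup>2 = 2"
    by (simp add: power2_eq_square algebra_simps)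
  then have "\<bar>q - 1\<bar> = sqrt 2"
    by (metis real_sqrt_abs)
  moreover have "\<not> q - 1 < 0"
  proof
    assume "q - 1 < 0"
    with \<open>\<bar>q - 1\<bar> = sqrt 2\<close> have "q = 1 - sqrt 2"
      by linarith
    with q show False
      using real_less_rsqrt[of 1 2] by simp
  qed
  ultimately show ?thesis
    by (simp add: q_def)
qed

text \<open>By \<open>annular_sector_discrepancy_split\<close> below, differences of the sawtooth sum \<open>E\<close> are the
  discrepancies of arcs. The two errors in
  \<open>sawtooth_sum_oscillation\<close> are \<open>3 N \<delta>\<close> and \<open>4 B\<close>, where \<open>B\<close> comes from Borel--Caratheodory and is about
  \<open>N y\<^sup>2 c / \<pi>\<close> with \<open>c = (1 + \<rho>)/(1 - \<rho>)\<close>. The condition on the mass of the kernel forces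
  \<open>c \<delta>\<close> to be at least about \<open>tan (3 \<pi>/8) / \<pi>\<close>, so the sum of the errors is least when \<open>\<delta>\<close> is about
  \<open>4/7 y\<close>.\<close>
lemma erdos_turan_unit_circle:
  fixes x :: "'i \<Rightarrow> real" and E :: "real \<Rightarrow> real" and y :: real
  assumes E_def: "\<And>y. E y = (\<Sum>j\<in>J. (frac (x j - y) - 1/2))"
    and J: "finite J" and y: "0 < y" "y \<le> 2/9"
    and bound: "\<And>z. cmod z = 1 \<Longrightarrow> (\<Prod>j\<in>J. cmod (z - cis (2 * pi * x j))) \<le> exp (real (card J) * y\<^sup>2)"
  shows "\<bar>E a - E b\<bar> \<le> 7/2 * real (card J) * y"
proof -
  define N where "N = real (card J)"
  define q where "q = 1 + sqrt 2"
  define \<delta> where "\<delta> = 4/7 * y"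
  define c where "c = q / (pi * \<delta>)"
  define \<rho> where "\<rho> = (c - 1) / (c + 1)"
  define B where "B = N * y\<^sup>2 * (c - 1) / pi"
  have pi: "3.14 \<le> pi" "pi \<le> 3.15"
    using pi_approx by auto
  have q: "2.4 \<le> q" "q \<le> 2.4143"
    using real_le_rsqrt[of "1.4" 2] real_le_lsqrt[of "1.4143" 2] by (auto simp: q_def power2_eq_square)
  have \<delta>: "0 < \<delta>" "\<delta> < 1/2"
    using y by (auto simp: \<delta>_def)
  have "pi * \<delta> \<le> 3.15 * (8/63)"
    using pi y by (intro mult_mono) (auto simp: \<delta>_def)
  then have c: "1 \<le> c"
    unfolding c_def using q \<delta> by (simp add: pos_le_divide_eq)
  have \<rho>: "0 \<le> \<rho>" "\<rho> < 1"
    using c by (auto simp: \<rho>_def)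
  have "pi * \<delta> < pi / 2"
    using \<delta> by simp
  then have "pi * \<delta> \<le> tan (pi * \<delta>)"
    using abs_tan_ge[of "pi * \<delta>"] tan_gt_zero[of "pi * \<delta>"] \<delta> by simp
  then have "c * (pi * \<delta>) \<le> c * tan (pi * \<delta>)"
    using c by (intro mult_left_mono) auto
  moreover have "c * (pi * \<delta>) = q"
    unfolding c_def using \<delta> by simp
  ultimately have tan: "tan (3 * pi / 8) \<le> c * tan (pi * \<delta>)"
    by (simp add: tan_three_eighths_pi q_def)
  have core: "3/8 \<le> \<delta> - smooth_saw \<rho> \<delta>"
    unfolding \<rho>_def by (rule poisson_kernel_core_mass[OF c \<delta> tan])
  have B: "\<bar>\<Sum>j\<in>J. smooth_saw \<rho> (x j - u)\<bar> \<le> B" for u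
  proof -
    define z where "z = of_real \<rho> * cis (- 2 * pi * u)"
    have z: "cmod z = \<rho>"
      using \<rho> by (simp add: z_def norm_mult)
    have "of_real \<rho> * cis (2 * pi * (x j - u)) = z * cis (2 * pi * x j)" for j
      by (simp add: z_def mult.assoc cis_mult algebra_simps)
    then have "(\<Sum>j\<in>J. smooth_saw \<rho> (x j - u)) = Im (\<Sum>j\<in>J. Ln (1 - z * cis (2 * pi * x j))) / pi"
      by (simp add: smooth_saw_eq_Im_Ln[OF \<rho>] sum_divide_distrib)
    then have "\<bar>\<Sum>j\<in>J. smooth_saw \<rho> (x j - u)\<bar> \<le> cmod (\<Sum>j\<in>J. Ln (1 - z * cis (2 * pi * x j))) / pi"
      by (simp only: abs_divide abs_of_pos pi_gt_zero divide_right_mono abs_Im_le_cmod pi_ge_zero)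
    also have "\<dots> \<le> 2 * (N * y\<^sup>2) * cmod z / (1 - cmod z) / pi"
      using z \<rho> bound by (intro divide_right_mono sum_Ln_bound J) (auto simp: N_def)
    also have "\<dots> = B"
    proof -
      have "2 * \<rho> / (1 - \<rho>) = c - 1"
        unfolding \<rho>_def using c by (simp add: field_simps)
      have "2 * (N * y\<^sup>2) * cmod z / (1 - cmod z) / pi = N * y\<^sup>2 * (2 * \<rho> / (1 - \<rho>)) / pi"
        unfolding z by simp
      then show ?thesis
        unfolding \<open>2 * \<rho> / (1 - \<rho>) = c - 1\<close> B_def .
    qed
    finally show ?thesis .
  qed
  \<comment> \<open>Each of the two errors is at most about \<open>1.71 N y\<close>.\<close>
  have "3 * N * \<delta> + 4 * B \<le> 7/2 * N * y"
  proof -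
    have "9.8596 \<le> pi * pi"
      using mult_mono[OF pi(1) pi(1)] by simp
    then have "7 * q / (pi * pi) \<le> 7 * 2.4143 / 9.8596"
      using q by (intro frac_le) auto
    then have *: "12/7 + 7 * q / (pi * pi) \<le> 7/2"
      by simp
    have "4 * B \<le> 4 * (N * y\<^sup>2 * c / pi)"
      unfolding B_def by (intro mult_left_mono divide_right_mono) (auto simp: N_def)
    also have "\<dots> = (7 * q / (pi * pi)) * (N * y)"
      unfolding c_def \<delta>_def using y by (simp add: field_simps power2_eq_square)
    finally have "3 * N * \<delta> + 4 * B \<le> (12/7 + 7 * q / (pi * pi)) * (N * y)"
      by (simp add: \<delta>_def algebra_simps)
    also have "\<dots> \<le> 7/2 * (N * y)"
      using * y by (intro mult_right_mono) (auto simp: N_def)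
    finally show ?thesis
      by simp
  qed
  moreover have "E u - E v \<le> 3 * N * \<delta> + 4 * B" for u v
    unfolding N_def by (rule sawtooth_sum_oscillation[OF E_def J \<rho> \<delta> core B])
  from this[of a b] this[of b a] have "\<bar>E a - E b\<bar> \<le> 3 * N * \<delta> + 4 * B"
    by linarith
  ultimately show ?thesis
    by (simp add: N_def)
qed

section \<open>Zeros in an annular sector\<close>

text \<open>The squares of the two sides differ by \<open>(1 - t)\<^sup>2\<close>. This is Schur's observation: replacing a zero by its
  radial projection to the unit circle does not increase the modulus of the normalised polynomial on the circle.\<close>
lemma norm_diff_radial_projection_le:
  assumes "cmod z = 1" "cmod u = 1" "0 \<le> t"
  shows "sqrt t * cmod (z - u) \<le> cmod (z - of_real t * u)"
proof (rule power2_le_imp_le)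
  have zu: "(Re z)\<^sup>2 + (Im z)\<^sup>2 = 1" "(Re u)\<^sup>2 + (Im u)\<^sup>2 = 1"
    using assms by (simp_all add: cmod_power2[symmetric])
  define X where "X = Re z * Re u + Im z * Im u"
  have "(cmod (z - of_real t * u))\<^sup>2 = ((Re z)\<^sup>2 + (Im z)\<^sup>2) + t\<^sup>2 * ((Re u)\<^sup>2 + (Im u)\<^sup>2) - 2 * t * X"
    unfolding cmod_power2 X_def by (simp add: power2_eq_square algebra_simps)
  then have 1: "(cmod (z - of_real t * u))\<^sup>2 = 1 + t\<^sup>2 - 2 * t * X"
    by (simp add: zu)
  have "(cmod (z - u))\<^sup>2 = ((Re z)\<^sup>2 + (Im z)\<^sup>2) + ((Re u)\<^sup>2 + (Im u)\<^sup>2) - 2 * X"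
    unfolding cmod_power2 X_def by (simp add: power2_eq_square algebra_simps)
  then have 2: "(cmod (z - u))\<^sup>2 = 2 - 2 * X"
    by (simp add: zu)
  have "0 \<le> (1 - t)\<^sup>2"
    by simp
  then show "(sqrt t * cmod (z - u))\<^sup>2 \<le> (cmod (z - of_real t * u))\<^sup>2"
    unfolding power_mult_distrib 1 2 real_sqrt_pow2[OF assms(3)] by (simp add: power2_eq_square algebra_simps)
qed simp

text \<open>Between \<open>\<alpha>/(2\<pi>)\<close> and \<open>\<beta>/(2\<pi>)\<close> the sawtooth of a point decreases linearly by \<open>(\<beta> - \<alpha>)/(2\<pi>)\<close> in total and
  jumps up by 1 just after it passes the point. Its increment is therefore the indicator of the angular
  range \<open>[\<alpha>, \<beta>)\<close> minus \<open>(\<beta> - \<alpha>)/(2\<pi>)\<close>.\<close>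
lemma annular_sector_discrepancy_split:
  fixes a :: "nat \<Rightarrow> complex" and x :: "nat \<Rightarrow> real"
  assumes x: "\<And>j. x j = Arg2pi (a j) / (2 * pi)"
    and ang: "0 \<le> \<alpha>" "\<alpha> < \<beta>" "\<beta> < 2 * pi"
  shows "\<bar>(\<Sum>j<n. indicator (annular_sector r \<alpha> \<beta>) (a j)) - real n * ((\<beta> - \<alpha>) / (2 * pi))\<bar>
     \<le> \<bar>(\<Sum>j<n. (frac (x j - \<beta> / (2 * pi)) - 1/2)) - (\<Sum>j<n. (frac (x j - \<alpha> / (2 * pi)) - 1/2))\<bar>
        + real (card {j\<in>{..<n}. \<not> (r < cmod (a j) \<and> cmod (a j) < 1 / r)})"
proof -
  define S :: "complex set" where "S = {z. \<alpha> \<le> Arg2pi z \<and> Arg2pi z < \<beta>}"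
  define O' where "O' = {j\<in>{..<n}. \<not> (r < cmod (a j) \<and> cmod (a j) < 1 / r)}"
  have sawtooth_diff: "frac (x j - \<beta> / (2 * pi)) - frac (x j - \<alpha> / (2 * pi)) = indicator S (a j) - (\<beta> - \<alpha>) / (2 * pi)" for j
  proof -
    have frac_eq: "frac (v - w) = v - w + (if v < w then 1 else 0)"
      if "0 \<le> v" "v < 1" "0 \<le> w" "w < 1" for v w :: real
      unfolding frac_unique_iff using that by auto
    have rng: "0 \<le> x j" "x j < 1" "0 \<le> \<beta> / (2 * pi)" "\<beta> / (2 * pi) < 1" "0 \<le> \<alpha> / (2 * pi)" "\<alpha> / (2 * pi) < 1"
      using Arg2pi_ge_0[of "a j"] Arg2pi_lt_2pi[of "a j"] ang by (auto simp: x)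
    have cmp: "x j < v / (2 * pi) \<longleftrightarrow> Arg2pi (a j) < v" for v
      by (simp add: x divide_less_cancel)
    show ?thesis
      using ang rng by (simp add: frac_eq cmp S_def indicator_def diff_divide_distrib)
  qed
  have "(\<Sum>j<n. (frac (x j - \<beta> / (2 * pi)) - 1/2)) - (\<Sum>j<n. (frac (x j - \<alpha> / (2 * pi)) - 1/2))
      = (\<Sum>j<n. frac (x j - \<beta> / (2 * pi)) - frac (x j - \<alpha> / (2 * pi)))"
    by (simp add: sum_subtractf)
  also have "\<dots> = (\<Sum>j<n. indicator S (a j)) - real n * ((\<beta> - \<alpha>) / (2 * pi))"
    unfolding sawtooth_diff by (simp add: sum_subtractf)
  finally have E: "(\<Sum>j<n. (frac (x j - \<beta> / (2 * pi)) - 1/2)) - (\<Sum>j<n. (frac (x j - \<alpha> / (2 * pi)) - 1/2))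
      = (\<Sum>j<n. indicator S (a j)) - real n * ((\<beta> - \<alpha>) / (2 * pi))" .
  have "\<bar>(\<Sum>j<n. indicator S (a j)) - (\<Sum>j<n. indicator (annular_sector r \<alpha> \<beta>) (a j) :: real)\<bar>
      \<le> (\<Sum>j<n. \<bar>indicator S (a j) - indicator (annular_sector r \<alpha> \<beta>) (a j)\<bar>)"
    unfolding sum_subtractf[symmetric] by (rule sum_abs)
  also have "\<dots> \<le> (\<Sum>j<n. if j \<in> O' then 1 else 0)"
    by (intro sum_mono) (auto simp: S_def O'_def annular_sector_def indicator_def)
  also have "\<dots> = card O'"
    by (simp add: sum.If_cases O'_def Int_def)
  finally show ?thesis
    unfolding E O'_def[symmetric] by linarith
qed

text \<open>Replacing the factor \<open>z - a\<^sub>j\<close> by \<open>1 - cnj a\<^sub>j z\<close> when \<open>\<bar>a\<^sub>j\<bar> \<le> 1\<close> keeps the modulus on the unit circle, and at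
  the origin gives \<open>\<bar>c\<bar> \<Prod> max 1 \<bar>a\<^sub>j\<bar> \<le> S\<close> by the maximum principle. Squaring and dividing by the moduli of
  the leading and the constant coefficient leaves \<open>\<Prod> max \<bar>a\<^sub>j\<bar> (1/\<bar>a\<^sub>j\<bar>)\<close>, to which each zero outside the annulus
  contributes at least \<open>1/r\<close>.\<close>
lemma zeros_off_annulus_bound:
  fixes a :: "nat \<Rightarrow> complex"
  assumes c: "c \<noteq> 0" and a: "\<And>j. j < n \<Longrightarrow> a j \<noteq> 0"
    and S: "\<And>z. cmod z = 1 \<Longrightarrow> cmod c * (\<Prod>j<n. cmod (z - a j)) \<le> S"
    and r: "0 < r" "r < 1"
  shows "(1 - r) * real (card {j\<in>{..<n}. \<not> (r < cmod (a j) \<and> cmod (a j) < 1 / r)})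
    \<le> 2 * ln (S / sqrt (cmod c * (cmod c * (\<Prod>j<n. cmod (a j)))))"
proof -
  define A where "A = (\<Prod>j<n. cmod (a j))"
  define f where "f j z = (if cmod (a j) \<le> 1 then 1 - cnj (a j) * z else z - a j)" for j z
  have A: "0 < A"
    unfolding A_def using a by (intro prod_pos) auto
  have hol: "(\<lambda>z. f j z) holomorphic_on T" for j T
    by (cases "cmod (a j) \<le> 1") (auto simp: f_def intro!: holomorphic_intros)
  have at0: "cmod (c * (\<Prod>j<n. f j 0)) \<le> S"
  proof (rule norm_le_on_disc_of_le_on_circle[where f = "\<lambda>z. c * (\<Prod>j<n. f j z)"])
    show "(\<lambda>z. c * (\<Prod>j<n. f j z)) holomorphic_on ball 0 1"
      by (intro holomorphic_intros hol)
    show "continuous_on (cball 0 1) (\<lambda>z. c * (\<Prod>j<n. f j z))"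
      by (intro continuous_intros holomorphic_on_imp_continuous_on hol)
    fix z :: complex
    assume z: "cmod z = 1"
    have "cmod (1 - cnj (a j) * z) = cmod (z - a j)" for j
    proof -
      have "z * cnj z = 1"
        using z by (simp add: complex_norm_square[symmetric])
      then have "1 - cnj (a j) * z = z * cnj (z - a j)"
        by (simp add: algebra_simps)
      then have "cmod (1 - cnj (a j) * z) = cmod z * cmod (cnj (z - a j))"
        by (simp only: norm_mult)
      then show ?thesis
        using z by (simp only: complex_mod_cnj mult_1_left)
    qed
    then have "cmod (f j z) = cmod (z - a j)" for j
      by (simp add: f_def)
    then show "cmod (c * (\<Prod>j<n. f j z)) \<le> S"
      using S[OF z] by (simp add: norm_mult prod_norm[symmetric])
  qed simp
  have "cmod (f j 0) = max 1 (cmod (a j))" for j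
    by (simp add: f_def)
  with at0 have S1: "cmod c * (\<Prod>j<n. max 1 (cmod (a j))) \<le> S"
    by (simp add: norm_mult prod_norm[symmetric])
  define Q where "Q = (\<Prod>j<n. max 1 (cmod (a j)))"
  have Q: "1 \<le> Q"
    unfolding Q_def by (intro prod_ge_1) auto
  have cS: "0 < cmod c * Q"
    using c Q by (intro mult_pos_pos) auto
  have "0 < S"
    using cS S1 by (simp add: Q_def)
  have each: "cmod (a j) * (if r < cmod (a j) \<and> cmod (a j) < 1 / r then 1 else inverse r) \<le> (max 1 (cmod (a j)))\<^sup>2"
    if "j < n" for j
  proof (cases "r < cmod (a j) \<and> cmod (a j) < 1 / r")
    case True
    have "cmod (a j) * 1 \<le> max 1 (cmod (a j)) * max 1 (cmod (a j))"
      by (intro mult_mono) auto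
    with True show ?thesis
      by (simp add: power2_eq_square)
  next
    case False
    then consider "cmod (a j) \<le> r" | "inverse r \<le> cmod (a j)"
      by (auto simp: not_less divide_inverse)
    then have "cmod (a j) * inverse r \<le> max 1 (cmod (a j)) * max 1 (cmod (a j))"
    proof cases
      case 1
      then have "cmod (a j) * inverse r \<le> 1 * 1"
        using r by (simp add: divide_inverse[symmetric])
      also have "\<dots> \<le> max 1 (cmod (a j)) * max 1 (cmod (a j))"
        by (intro mult_mono) auto
      finally show ?thesis .
    next
      case 2
      with r show ?thesis
        by (intro mult_mono) auto
    qed
    then show ?thesis
      unfolding power2_eq_square if_not_P[OF False] .
  qed
  define k where "k = card {j\<in>{..<n}. \<not> (r < cmod (a j) \<and> cmod (a j) < 1 / r)}"
  have "(\<Prod>j<n. if r < cmod (a j) \<and> cmod (a j) < 1 / r then 1 else inverse r) = inverse r ^ k"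
    by (simp add: prod.If_cases k_def Int_def)
  then have "A * inverse r ^ k = (\<Prod>j<n. cmod (a j) * (if r < cmod (a j) \<and> cmod (a j) < 1 / r then 1 else inverse r))"
    by (simp add: A_def prod.distrib)
  also have "\<dots> \<le> (\<Prod>j<n. (max 1 (cmod (a j)))\<^sup>2)"
    using each r by (intro prod_mono) auto
  also have "\<dots> = Q\<^sup>2"
    by (simp add: Q_def prod_power_distrib)
  finally have "(cmod c)\<^sup>2 * (A * inverse r ^ k) \<le> (cmod c)\<^sup>2 * Q\<^sup>2"
    by (intro mult_left_mono) auto
  also have "\<dots> = (cmod c * Q)\<^sup>2"
    by (simp add: power_mult_distrib)
  also have "\<dots> \<le> S\<^sup>2"
    using cS S1 by (intro power_mono) (auto simp: Q_def)
  finally have "inverse r ^ k * (cmod c * (cmod c * A)) \<le> S\<^sup>2"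
    by (simp add: power2_eq_square mult_ac)
  moreover have D: "0 < cmod c * (cmod c * A)"
    using c A by simp
  ultimately have "inverse r ^ k \<le> S\<^sup>2 / (cmod c * (cmod c * A))"
    by (simp only: pos_le_divide_eq)
  then have "ln (inverse r ^ k) \<le> ln (S\<^sup>2 / (cmod c * (cmod c * A)))"
    using r D \<open>0 < S\<close> by (subst ln_le_cancel_iff) auto
  also have "S\<^sup>2 / (cmod c * (cmod c * A)) = (S / sqrt (cmod c * (cmod c * A)))\<^sup>2"
    using D by (simp add: power_divide)
  also have "ln \<dots> = 2 * ln (S / sqrt (cmod c * (cmod c * A)))"
    using D \<open>0 < S\<close> by (subst ln_realpow) auto
  also have "ln (inverse r ^ k) = k * ln (inverse r)"
    using r by (simp add: ln_realpow)
  finally have "k * ln (inverse r) \<le> 2 * ln (S / sqrt (cmod c * (cmod c * A)))" .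
  moreover have "1 - r \<le> ln (inverse r)"
    using ln_le_minus_one[of r] r by (simp add: ln_inverse)
  then have "k * (1 - r) \<le> k * ln (inverse r)"
    by (intro mult_left_mono) auto
  ultimately show ?thesis
    unfolding k_def A_def by (simp add: mult.commute)
qed

lemma catalan_const_bounds: "0 < catalan_const" "catalan_const \<le> 1"
proof -
  define a where "a k = 1 / (2 * real k + 1)\<^sup>2" for k
  have lim: "a \<longlonglongrightarrow> 0"
    unfolding a_def by real_asymp
  have nn: "0 \<le> a k" for k
    by (simp add: a_def)
  have mono: "a (Suc k) \<le> a k" for k
    unfolding a_def by (intro divide_left_mono power_mono mult_pos_pos zero_less_power) auto
  have s: "catalan_const = (\<Sum>k. (-1) ^ k * a k)"
    by (simp add: catalan_const_def a_def)
  have "catalan_const \<le> (\<Sum>i<2 * 0 + 1. (-1) ^ i * a i)"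
    unfolding s by (rule summable_Leibniz'(4)[OF lim nn mono])
  then show "catalan_const \<le> 1"
    by (simp add: a_def)
  have "(\<Sum>i<2 * 1. (-1) ^ i * a i) \<le> catalan_const"
    unfolding s by (rule summable_Leibniz'(2)[OF lim nn mono])
  then show "0 < catalan_const"
    by (simp add: a_def numeral_2_eq_2)
qed

lemma complex_poly_zeros_enumeration:
  fixes p :: "complex poly"
  obtains a :: "nat \<Rightarrow> complex" where
    "\<And>z. poly p z = lead_coeff p * (\<Prod>j<degree p. z - a j)"
    "\<And>f :: complex \<Rightarrow> real. (\<Sum>z\<in>#proots p. f z) = (\<Sum>j<degree p. f (a j))"
proof -
  obtain zs where zs: "mset zs = proots p"
    using ex_mset by blast
  have len: "length zs = degree p"
    using zs size_proots_complex[of p] by (metis size_mset)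
  show ?thesis
  proof
    fix z :: complex
    have *: "poly (\<Prod>x\<leftarrow>xs. [:-x, 1:]) z = (\<Prod>x\<leftarrow>xs. z - x)" for xs
      by (induction xs) (auto simp: algebra_simps)
    have "poly p z = poly (smult (lead_coeff p) (\<Prod>x\<in>#proots p. [:-x, 1:])) z"
      by (simp only: complex_poly_decompose_multiset)
    also have "\<dots> = lead_coeff p * (\<Prod>x\<leftarrow>zs. z - x)"
      by (simp add: zs[symmetric] prod_mset_prod_list * flip: mset_map)
    also have "\<dots> = lead_coeff p * (\<Prod>j<degree p. z - zs ! j)"
      by (simp add: prod.list_conv_set_nth len atLeast0LessThan)
    finally show "poly p z = lead_coeff p * (\<Prod>j<degree p. z - zs ! j)" .
  next
    fix f :: "complex \<Rightarrow> real"
    have "(\<Sum>z\<in>#proots p. f z) = (\<Sum>x\<leftarrow>zs. f x)"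
      by (simp add: zs[symmetric] sum_mset_sum_list flip: mset_map)
    then show "(\<Sum>z\<in>#proots p. f z) = (\<Sum>j<degree p. f (zs ! j))"
      by (simp add: sum.list_conv_set_nth len atLeast0LessThan)
  qed
qed

text \<open>The sum of the moduli is at least twice the geometric mean of the first and the last of them, whence the
  bound \<open>ln 2\<close>. It makes \<open>h\<close> positive here, and the upper bound for its expectation positive later.\<close>
lemma erdos_turan_annular_sector:
  fixes p :: "complex poly"
  defines "n \<equiv> degree p"
  defines "h \<equiv> ln ((\<Sum>k\<le>n. cmod (coeff p k)) / sqrt (cmod (coeff p 0) * cmod (coeff p n)))"
  assumes n: "0 < n" and p0: "coeff p 0 \<noteq> 0"
    and r: "0 < r" "r < 1" and ang: "0 \<le> \<alpha>" "\<alpha> < \<beta>" "\<beta> < 2 * pi"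
  shows "ln 2 \<le> h"
    and "\<bar>zero_counting n p (annular_sector r \<alpha> \<beta>) - (\<beta> - \<alpha>) / (2 * pi)\<bar>
      \<le> (sqrt (2 * pi / catalan_const) + 2 / (1 - r)) * sqrt (h / n)"
proof -
  obtain a where a: "\<And>z. poly p z = lead_coeff p * (\<Prod>j<n. z - a j)"
    "\<And>f :: complex \<Rightarrow> real. (\<Sum>z\<in>#proots p. f z) = (\<Sum>j<n. f (a j))"
    using complex_poly_zeros_enumeration[of p] unfolding n_def by blast
  define S where "S = (\<Sum>k\<le>n. cmod (coeff p k))"
  define c where "c = coeff p n"
  define A where "A = (\<Prod>j<n. cmod (a j))"
  have c: "c \<noteq> 0"
    using n unfolding c_def n_def by (metis degree_0 leading_coeff_0_iff less_irrefl)
  have p0': "cmod (coeff p 0) = cmod c * A"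
    using a(1)[of 0] by (simp add: poly_0_coeff_0 c_def n_def A_def norm_mult prod_norm[symmetric])
  then have A: "0 < A"
    using p0 c by (metis A_def less_eq_real_def mult_eq_0_iff norm_eq_zero norm_ge_zero prod_nonneg)
  have a0: "a j \<noteq> 0" if "j < n" for j
    using A that unfolding A_def by (metis finite_lessThan lessThan_iff less_irrefl norm_zero prod_zero)
  have Pz: "cmod c * (\<Prod>j<n. cmod (z - a j)) \<le> S" if "cmod z = 1" for z
  proof -
    have "cmod c * (\<Prod>j<n. cmod (z - a j)) = cmod (poly p z)"
      by (simp add: a(1) c_def n_def norm_mult prod_norm[symmetric])
    also have "\<dots> \<le> (\<Sum>k\<le>n. cmod (coeff p k * z ^ k))"
      unfolding poly_altdef n_def by (rule norm_sum)
    finally show ?thesis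
      using that by (simp add: S_def norm_mult norm_power)
  qed
  define R where "R = sqrt (cmod c * (cmod c * A))"
  have R: "0 < R"
    using c A by (simp add: R_def)
  have h: "h = ln (S / R)"
    by (simp add: h_def S_def R_def p0' c_def mult_ac)
  have "2 * R \<le> S"
  proof -
    have "2 * R \<le> cmod c + cmod (coeff p 0)"
      using arith_geo_mean_sqrt[of "cmod c" "cmod (coeff p 0)"] by (simp add: R_def flip: p0')
    also have "\<dots> = (\<Sum>k\<in>{0, n}. cmod (coeff p k))"
      using n by (simp add: c_def)
    also have "\<dots> \<le> S"
      unfolding S_def by (intro sum_mono2) auto
    finally show ?thesis .
  qed
  then have SR: "2 \<le> S / R"
    using R by (simp add: pos_le_divide_eq)
  then show h2: "ln 2 \<le> h"
    unfolding h by (subst ln_le_cancel_iff) auto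
  have "0 < ln (2::real)"
    by simp
  with h2 have hpos: "0 < h"
    by linarith
  have exp_h: "exp h = S / R"
    unfolding h using SR by (intro exp_ln) simp
  define y where "y = sqrt (h / n)"
  have y: "0 < y" and ny: "real n * y\<^sup>2 = h"
    using hpos n by (simp_all add: y_def)
  define \<kappa> where "\<kappa> = sqrt (2 * pi / catalan_const)"
  have \<kappa>: "5/2 \<le> \<kappa>"
  proof -
    have "(5/2)\<^sup>2 \<le> 2 * pi / 1"
      using pi_approx by (simp add: power2_eq_square)
    also have "\<dots> \<le> 2 * pi / catalan_const"
      using catalan_const_bounds by (intro divide_left_mono) auto
    finally show ?thesis
      unfolding \<kappa>_def by (rule real_le_rsqrt)
  qed
  define t where "t = 2 / (1 - r)"
  have t: "2 \<le> t"
    using r by (simp add: t_def pos_le_divide_eq)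
  define \<tau> where "\<tau> = zero_counting n p (annular_sector r \<alpha> \<beta>)"
  have \<tau>: "\<tau> = (\<Sum>j<n. indicator (annular_sector r \<alpha> \<beta>) (a j)) / n"
    by (simp add: \<tau>_def zero_counting_def a(2))
  have "\<bar>\<tau> - (\<beta> - \<alpha>) / (2 * pi)\<bar> \<le> (\<kappa> + t) * y"
  \<comment> \<open>In the first case the right-hand side is at least the trivial bound 1. In the second, \<open>y \<le> 2/9\<close>
    and \<open>t y \<le> 1\<close> leave room for the angular constant \<open>7/2\<close>.\<close>
  proof (cases "1 \<le> (\<kappa> + t) * y")
    case True
    have "(\<Sum>j<n. indicator (annular_sector r \<alpha> \<beta>) (a j)) \<le> (\<Sum>j<n. 1::real)"
      by (intro sum_mono) (simp add: indicator_def)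
    then have "0 \<le> \<tau>" "\<tau> \<le> 1"
      using n by (auto simp: \<tau> sum_nonneg divide_le_eq)
    moreover have "0 \<le> (\<beta> - \<alpha>) / (2 * pi)" "(\<beta> - \<alpha>) / (2 * pi) \<le> 1"
      using ang by (auto simp: divide_le_eq)
    ultimately show ?thesis
      using True by linarith
  next
    case False
    have "9/2 * y \<le> (\<kappa> + t) * y"
      using \<kappa> t y by (intro mult_right_mono) auto
    with False have y9: "y \<le> 2/9"
      by simp
    have "t * y \<le> (\<kappa> + t) * y"
      using \<kappa> y by (intro mult_right_mono) auto
    with False have ty: "t * y \<le> 1"
      by linarith
    define x where "x j = Arg2pi (a j) / (2 * pi)" for j
    define E where "E u = (\<Sum>j<n. (frac (x j - u) - 1/2))" for u
    define k where "k = real (card {j\<in>{..<n}. \<not> (r < cmod (a j) \<and> cmod (a j) < 1 / r)})"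
    have "(1 - r) * k \<le> 2 * h"
      unfolding h R_def A_def k_def by (rule zeros_off_annulus_bound[OF c a0 Pz r])
    then have k: "k \<le> t * h"
      using r by (simp add: t_def pos_le_divide_eq mult.commute)
    have circ: "(\<Prod>j<n. cmod (z - cis (2 * pi * x j))) \<le> exp (real (card {..<n}) * y\<^sup>2)" if z: "cmod z = 1" for z
    proof -
      have "sqrt (cmod (a j)) * cmod (z - cis (2 * pi * x j)) \<le> cmod (z - a j)" for j
      proof -
        have "a j = of_real (cmod (a j)) * cis (2 * pi * x j)"
          using Arg2pi_eq[of "a j"] by (simp add: x_def cis_conv_exp)
        then show ?thesis
          using norm_diff_radial_projection_le[OF z, of "cis (2 * pi * x j)" "cmod (a j)"] by simp
      qed
      then have "(\<Prod>j<n. sqrt (cmod (a j)) * cmod (z - cis (2 * pi * x j))) \<le> (\<Prod>j<n. cmod (z - a j))"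
        by (intro prod_mono) auto
      then have "cmod c * ((\<Prod>j<n. sqrt (cmod (a j))) * (\<Prod>j<n. cmod (z - cis (2 * pi * x j)))) \<le> S"
        using Pz[OF z] by (simp add: prod.distrib) (meson mult_left_mono norm_ge_zero order.trans)
      moreover have "cmod c * (\<Prod>j<n. sqrt (cmod (a j))) = R"
      proof -
        have "(\<Prod>j<m. sqrt (cmod (a j))) = sqrt (\<Prod>j<m. cmod (a j))" for m
          by (induction m) (auto simp: real_sqrt_mult)
        then show ?thesis
          by (simp add: R_def A_def real_sqrt_mult flip: mult.assoc)
      qed
      ultimately have "R * (\<Prod>j<n. cmod (z - cis (2 * pi * x j))) \<le> S"
        by (metis mult.assoc)
      then show ?thesis
        using R by (simp add: ny exp_h pos_le_divide_eq mult.commute)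
    qed
    have "\<bar>(\<Sum>j<n. indicator (annular_sector r \<alpha> \<beta>) (a j)) - real n * ((\<beta> - \<alpha>) / (2 * pi))\<bar>
        \<le> \<bar>E (\<beta> / (2 * pi)) - E (\<alpha> / (2 * pi))\<bar> + k"
      unfolding E_def k_def by (rule annular_sector_discrepancy_split[OF x_def ang])
    moreover have "\<bar>E (\<beta> / (2 * pi)) - E (\<alpha> / (2 * pi))\<bar> \<le> 7/2 * real (card {..<n}) * y"
      by (rule erdos_turan_unit_circle[OF E_def _ y y9 circ]) auto
    moreover have "(\<Sum>j<n. indicator (annular_sector r \<alpha> \<beta>) (a j)) = n * \<tau>"
      using n by (simp add: \<tau>)
    ultimately have "\<bar>n * \<tau> - n * ((\<beta> - \<alpha>) / (2 * pi))\<bar> \<le> 7/2 * n * y + t * h"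
      using k by simp
    also have "t * h = (t * y) * (n * y)"
      unfolding ny[symmetric] by (simp add: power2_eq_square)
    also have "\<dots> \<le> 1 * (n * y)"
      using ty y by (intro mult_right_mono) auto
    finally have "\<bar>n * (\<tau> - (\<beta> - \<alpha>) / (2 * pi))\<bar> \<le> n * (9/2 * y)"
      by (simp add: algebra_simps)
    then have "real n * \<bar>\<tau> - (\<beta> - \<alpha>) / (2 * pi)\<bar> \<le> n * (9/2 * y)"
      unfolding abs_mult by simp
    then have "\<bar>\<tau> - (\<beta> - \<alpha>) / (2 * pi)\<bar> \<le> 9/2 * y"
      using n by (simp only: mult_le_cancel_left_pos of_nat_0_less_iff)
    with \<open>9/2 * y \<le> (\<kappa> + t) * y\<close> show ?thesis
      by linarith
  qed
  then show "\<bar>zero_counting n p (annular_sector r \<alpha> \<beta>) - (\<beta> - \<alpha>) / (2 * pi)\<bar>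
      \<le> (sqrt (2 * pi / catalan_const) + 2 / (1 - r)) * sqrt (h / n)"
    unfolding \<tau>_def \<kappa>_def t_def y_def .
qed

section \<open>Random coefficients\<close>

text \<open>As \<open>ln x \<le> x\<close>, only the negative part of the logarithm can fail to be integrable.\<close>
lemma log_moment_cases:
  assumes int: "integrable M (\<lambda>\<omega>. cmod (X \<omega>))"
  obtains "log_moment M X = -\<infinity>"
  | "integrable M (\<lambda>\<omega>. ln (cmod (X \<omega>)))"
    "log_moment M X = ereal (integral\<^sup>L M (\<lambda>\<omega>. ln (cmod (X \<omega>))))"
proof -
  define f where "f \<omega> = ln (cmod (X \<omega>))" for \<omega>
  define P where "P = (\<integral>\<^sup>+\<omega>. ennreal (f \<omega>) \<partial>M)"
  define N where "N = (\<integral>\<^sup>+\<omega>. ennreal (- f \<omega>) \<partial>M)"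
  have meas: "f \<in> borel_measurable M"
    unfolding f_def using borel_measurable_integrable[OF int] by measurable
  have lm: "log_moment M X = enn2ereal P - enn2ereal N"
    by (simp add: log_moment_def ext_expectation_def P_def N_def f_def)
  have "f \<omega> \<le> cmod (X \<omega>)" for \<omega>
    unfolding f_def by (cases "X \<omega> = 0") (auto intro: order.trans[OF ln_le_minus_one])
  then have "P \<le> (\<integral>\<^sup>+\<omega>. ennreal (cmod (X \<omega>)) \<partial>M)"
    unfolding P_def by (intro nn_integral_mono ennreal_leI)
  also have "\<dots> < \<infinity>"
    using int by (simp add: integrable_iff_bounded)
  finally have P: "P < \<infinity>" .
  show ?thesis
  proof (cases "N = \<infinity>")
    case True
    then have "log_moment M X = -\<infinity>"
      unfolding lm using P by (cases P) (auto simp: top_ereal_def)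
    then show ?thesis
      by (rule that)
  next
    case False
    have "integrable M f"
      unfolding real_integrable_def using meas P False by (simp add: P_def N_def less_top)
    moreover have "log_moment M X = ereal (integral\<^sup>L M f)"
      unfolding lm real_lebesgue_integral_def[OF calculation] P_def[symmetric] N_def[symmetric]
      using P False by (cases P; cases N) auto
    ultimately show ?thesis
      using that(2) unfolding f_def by blast
  qed
qed

lemma distributed_lborel_AE_neq:
  fixes X :: "'a \<Rightarrow> 'b :: euclidean_space"
  assumes "distributed M lborel X f"
  shows "AE \<omega> in M. X \<omega> \<noteq> c"
proof -
  have "AE x in density lborel f. x \<noteq> c"
    using AE_lborel_singleton[of c] distributed_borel_measurable[OF assms] by (auto simp: AE_density)
  then have "AE x in distr M lborel X. x \<noteq> c"
    by (simp only: distributed_distr_eq_density[OF assms])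
  with distributed_measurable[OF assms] show ?thesis
    by (rule AE_distrD)
qed

lemma coeff_rand_poly: "coeff (rand_poly C n \<omega>) k = (if k \<le> n then C k \<omega> else 0)"
  by (simp add: rand_poly_def coeff_sum)

lemma degree_rand_poly:
  assumes "C n \<omega> \<noteq> 0"
  shows "degree (rand_poly C n \<omega>) = n"
  by (intro antisym degree_le le_degree) (use assms in \<open>auto simp: coeff_rand_poly\<close>)

theorem theorem3p7:
  fixes M :: "'a measure" and C :: "nat \<Rightarrow> 'a \<Rightarrow> complex"
    and \<mu> \<sigma> r \<alpha> \<beta> :: real
  assumes "prob_space M"
    and "\<And>k. \<exists>f. distributed M lborel (C k) f"
    and "\<And>k. integrable M (\<lambda>\<omega>. cmod (C k \<omega>))"
    and "\<And>k. prob_space.expectation M (\<lambda>\<omega>. cmod (C k \<omega>)) = \<mu>"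
    and "\<And>k. integrable M (\<lambda>\<omega>. (cmod (C k \<omega>))\<^sup>2)"
    and "\<And>k. prob_space.variance M (\<lambda>\<omega>. cmod (C k \<omega>)) = \<sigma>\<^sup>2"
    and "0 < r" "r < 1"
    and "0 \<le> \<alpha>" "\<alpha> < \<beta>" "\<beta> < 2 * pi"
  shows "\<exists>g :: nat \<Rightarrow> real. g \<in> O(\<lambda>_. 1) \<and>
    (\<forall>\<^sub>F n in sequentially.
      ereal (prob_space.expectation M
        (\<lambda>\<omega>. \<bar>zero_counting n (rand_poly C n \<omega>) (annular_sector r \<alpha> \<beta>) - (\<beta> - \<alpha>) / (2 * pi)\<bar>))
      \<le> ereal (sqrt (2 * pi / catalan_const) + 2 / (1 - r))
          * sqrt_term n (log_moment M (C 0)) (log_moment M (C n)) (g n))"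
proof (intro exI conjI)
  interpret prob_space M
    by (rule assms(1))
  show "(\<lambda>_. ln \<mu>) \<in> O(\<lambda>_. 1)"
    by simp
  have ne: "AE \<omega> in M. C k \<omega> \<noteq> 0" for k
    using assms(2)[of k] distributed_lborel_AE_neq by blast
  have \<mu>: "0 < \<mu>"
  proof -
    have "0 \<le> \<mu>"
      unfolding assms(4)[of 0, symmetric] by simp
    moreover have "\<mu> \<noteq> 0"
    proof
      assume "\<mu> = 0"
      then have "AE \<omega> in M. cmod (C 0 \<omega>) = 0"
        using assms(3,4)[of 0] by (subst integral_nonneg_eq_0_iff_AE[symmetric]) auto
      with ne[of 0] have "AE \<omega> in M. False"
        by eventually_elim simp
      then show False
        by simp
    qed
    ultimately show ?thesis
      by simp
  qed
  define L where "L = sqrt (2 * pi / catalan_const) + 2 / (1 - r)"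
  have L: "0 < L"
    unfolding L_def using catalan_const_bounds assms(8) by (intro add_nonneg_pos) auto
  show "\<forall>\<^sub>F n in sequentially.
      ereal (expectation
        (\<lambda>\<omega>. \<bar>zero_counting n (rand_poly C n \<omega>) (annular_sector r \<alpha> \<beta>) - (\<beta> - \<alpha>) / (2 * pi)\<bar>))
      \<le> ereal (sqrt (2 * pi / catalan_const) + 2 / (1 - r))
          * sqrt_term n (log_moment M (C 0)) (log_moment M (C n)) (ln \<mu>)"
    using eventually_gt_at_top[of 0]
  proof eventually_elim
    fix n :: nat
    assume n: "0 < n"
    define D where "D \<omega> = \<bar>zero_counting n (rand_poly C n \<omega>) (annular_sector r \<alpha> \<beta>) - (\<beta> - \<alpha>) / (2 * pi)\<bar>" for \<omega>
    have "ereal (expectation D) \<le> ereal L * sqrt_term n (log_moment M (C 0)) (log_moment M (C n)) (ln \<mu>)"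
    proof (cases "log_moment M (C 0) = -\<infinity> \<or> log_moment M (C n) = -\<infinity>")
      case True
      then show ?thesis
        using L by (simp add: sqrt_term_def)
    next
      case False
      define l where "l k \<omega> = ln (cmod (C k \<omega>))" for k \<omega>
      have l: "integrable M (l k)" "log_moment M (C k) = ereal (expectation (l k))" if "k = 0 \<or> k = n" for k
        using log_moment_cases[OF assms(3)[of k]] that False unfolding l_def by metis+
      define T where "T \<omega> = (\<Sum>k\<le>n. cmod (C k \<omega>))" for \<omega>
      have T: "integrable M T" "expectation T = (real n + 1) * \<mu>"
        unfolding T_def using assms(3,4) by (simp_all add: Bochner_Integration.integral_sum)
      define m where "m = (real n + 1) * \<mu>"
      have m: "0 < m"
        using \<mu> by (simp add: m_def)
      define H where "H \<omega> = T \<omega> / m - 1 + ln m - l 0 \<omega> / 2 - l n \<omega> / 2" for \<omega>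
      define B where "B = ln m - expectation (l 0) / 2 - expectation (l n) / 2"
      have H: "integrable M H" "expectation H = B"
        unfolding H_def B_def using T l m by (simp_all add: prob_space m_def[symmetric])
      \<comment> \<open>\<open>H\<close> replaces \<open>ln T\<close> in the deterministic bound by the tangent of the logarithm at the mean
        \<open>m\<close> of \<open>T\<close>, so that its expectation can be computed.\<close>
      have bound: "AE \<omega> in M. ln 2 \<le> H \<omega> \<and> D \<omega> \<le> L * sqrt (H \<omega> / n)"
        using ne[of 0] ne[of n]
      proof eventually_elim
        fix \<omega>
        assume C: "C 0 \<omega> \<noteq> 0" "C n \<omega> \<noteq> 0"
        define p where "p = rand_poly C n \<omega>"
        have deg: "degree p = n"
          unfolding p_def using C(2) by (rule degree_rand_poly)
        define h where "h = ln (T \<omega> / sqrt (cmod (C 0 \<omega>) * cmod (C n \<omega>)))"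
        have h: "ln 2 \<le> h" "D \<omega> \<le> L * sqrt (h / n)"
          using erdos_turan_annular_sector[of p r \<alpha> \<beta>] n C assms(7-)
          by (simp_all add: deg h_def D_def L_def T_def) (simp_all add: p_def coeff_rand_poly)
        have T0: "0 < T \<omega>"
          unfolding T_def using C by (intro sum_pos2[of _ 0]) auto
        have "h = ln (T \<omega>) - l 0 \<omega> / 2 - l n \<omega> / 2"
          unfolding h_def l_def using C T0 by (simp add: ln_div ln_sqrt ln_mult add_divide_distrib)
        also have "ln (T \<omega>) = ln (T \<omega> / m) + ln m"
          using T0 m by (simp add: ln_div)
        also have "ln (T \<omega> / m) \<le> T \<omega> / m - 1"
          using T0 m by (intro ln_le_minus_one) simp
        finally have hH: "h \<le> H \<omega>"
          by (simp add: H_def)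
        then have "L * sqrt (h / n) \<le> L * sqrt (H \<omega> / n)"
          using L n by (intro mult_left_mono real_sqrt_le_mono divide_right_mono) auto
        with h hH show "ln 2 \<le> H \<omega> \<and> D \<omega> \<le> L * sqrt (H \<omega> / n)"
          by linarith
      qed
      have "expectation (\<lambda>_. ln 2) \<le> expectation H"
        using bound H by (intro integral_mono_AE) auto
      then have B: "0 < B"
        using H by (simp add: prob_space less_le_trans[of 0 "ln 2"])
      define s where "s = sqrt (B / n)"
      have s: "0 < s" and ss: "B / n = s * s"
        using B n by (simp_all add: s_def)
      \<comment> \<open>Likewise \<open>\<surd>(H/n)\<close> lies below the tangent of the square root at the mean \<open>s\<^sup>2\<close> of \<open>H/n\<close>. If
        \<open>D\<close> is not integrable, its expectation is 0 by convention.\<close>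
      have "expectation D \<le> L * s"
      proof (cases "integrable M D")
        case True
        have "expectation D \<le> expectation (\<lambda>\<omega>. L * (H \<omega> / n / s + s) / 2)"
        proof (rule integral_mono_AE[OF True])
          show "AE \<omega> in M. D \<omega> \<le> L * (H \<omega> / n / s + s) / 2"
            using bound
          proof eventually_elim
            fix \<omega>
            assume b: "ln 2 \<le> H \<omega> \<and> D \<omega> \<le> L * sqrt (H \<omega> / n)"
            then have "0 \<le> H \<omega>"
              using ln_gt_zero[of 2] by linarith
            then have "sqrt ((H \<omega> / n / s) * s) \<le> (H \<omega> / n / s + s) / 2"
              using s by (intro arith_geo_mean_sqrt) auto
            then have "L * sqrt (H \<omega> / n) \<le> L * ((H \<omega> / n / s + s) / 2)"
              using s L by (intro mult_left_mono) auto
            with b show "D \<omega> \<le> L * (H \<omega> / n / s + s) / 2"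
              by simp
          qed
        qed (use H in auto)
        also have "\<dots> = L * (B / n / s + s) / 2"
          using H by (simp add: prob_space)
        also have "\<dots> = L * s"
          unfolding ss using s by simp
        finally show ?thesis .
      next
        case False
        then show ?thesis
          using L s by (simp add: not_integrable_integral_eq)
      qed
      also have "ereal (L * s) = ereal L * sqrt_term n (log_moment M (C 0)) (log_moment M (C n)) (ln \<mu>)"
      proof -
        have "ln m = ln (real n + 1) + ln \<mu>"
          unfolding m_def using \<mu> by (intro ln_mult_pos) auto
        then show ?thesis
          by (simp add: sqrt_term_def l s_def B_def algebra_simps)
      qed
      finally show ?thesis
        by simp
    qed
    then show "ereal (expectation
        (\<lambda>\<omega>. \<bar>zero_counting n (rand_poly C n \<omega>) (annular_sector r \<alpha> \<beta>) - (\<beta> - \<alpha>) / (2 * pi)\<bar>))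
      \<le> ereal (sqrt (2 * pi / catalan_const) + 2 / (1 - r))
          * sqrt_term n (log_moment M (C 0)) (log_moment M (C n)) (ln \<mu>)"
      unfolding D_def L_def .
  qed
qed

end
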